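(* Let $A\in SL_3(\mathbb{Z})$ and consider the matrix equation $X^2=A$ in $SL_3(\mathbb{Z})$. If a solution lies in $SL_3(\mathbb{Z})$, then the solution is a matrix $B$ defined by the formula $$B=\frac{A^2-\frac{(\operatorname{tr}B)^2+\operatorname{tr}A}{2}\,A-\operatorname{tr}(B)\,E}{1-\frac{(\operatorname{tr}B)^2-\operatorname{tr}A}{2}\operatorname{tr}B}.$$
   Context: $SL_3(\mathbb{Z})$ is the group of $3\times 3$ integer matrices of determinant $1$, $E$ is the $3\times 3$ identity matrix and $\operatorname{tr}$ denotes the trace. The denominator is a scalar by which the matrix in the numerator is divided.
   Formalization: The formula is proved for every solution B whose denominator is nonzero; this is assumed because for some solutions, e.g. B = diag(-1,-1,1) with A = E, numerator and denominator both vanish and the formula is undefined. *)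

theory Defs
  imports "HOL-Analysis.Analysis"
begin

definition SL3Z :: "(int^3^3) set" where
  "SL3Z = {M. det M = 1}"

definition real_matrix :: "int^'n^'m \<Rightarrow> real^'n^'m" where
  "real_matrix M = map_matrix real_of_int M"

end

theory Submission
  imports Defs
begin

text \<open>Write \<open>t\<close> for the trace of \<open>B\<close> and \<open>s = (t\<^sup>2 - tr A) / 2\<close> for its second invariant.
  Cayley--Hamilton gives \<open>B\<^sup>3 = t A - s B + E\<close>. Multiplying by \<open>B\<close> and substituting once more,
  \<open>A\<^sup>2 = B\<^sup>4 = (t\<^sup>2 - s) A + (1 - s t) B + t E\<close>, which is linear in \<open>B\<close>.\<close>

text \<open>Entrywise, these are nine polynomial identities. The sum of the principal 2x2 minors is
  expressed through traces, so that \<open>trace (M ** M)\<close> can later become the trace of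
  \<open>A\<close>.\<close>

lemma cayley_hamilton_3:
  fixes M :: "real^3^3"
  shows "M ** M ** M = trace M *\<^sub>R (M ** M)
    - (((trace M)\<^sup>2 - trace (M ** M)) / 2) *\<^sub>R M + det M *\<^sub>R mat 1"
  by (simp add: vec_eq_iff forall_3 matrix_matrix_mult_def sum_3 trace_def det_3 mat_def
      power2_eq_square field_simps)

lemma matrix_combination_mult:
  fixes M N :: "real^'n^'n" and P :: "real^'m^'n"
  shows "(a *\<^sub>R M - b *\<^sub>R N + mat 1) ** P = a *\<^sub>R (M ** P) - b *\<^sub>R (N ** P) + P"
proof -
  have "(a *\<^sub>R M - b *\<^sub>R N + mat 1) ** P = a *\<^sub>R (M ** P) - b *\<^sub>R (N ** P) + mat 1 ** P"
    by (simp add: vec_eq_iff matrix_matrix_mult_def sum.distrib sum_subtractf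
        sum_distrib_left algebra_simps)
  then show ?thesis by simp
qed

lemma matrix_power4_3:
  fixes M :: "real^3^3"
  assumes "det M = 1"
  shows "(M ** M) ** (M ** M) =
    (((trace M)\<^sup>2 + trace (M ** M)) / 2) *\<^sub>R (M ** M)
      + (1 - ((trace M)\<^sup>2 - trace (M ** M)) / 2 * trace M) *\<^sub>R M + trace M *\<^sub>R mat 1"
proof -
  define t where "t = trace M"
  define s where "s = (t\<^sup>2 - trace (M ** M)) / 2"
  have cube: "M ** M ** M = t *\<^sub>R (M ** M) - s *\<^sub>R M + mat 1"
    using cayley_hamilton_3[of M] assms by (simp add: t_def s_def)
  \<comment> \<open>Rebracketing exposes the cube as a left factor, ready for
    \<open>cube\<close>.\<close>
  have "(M ** M) ** (M ** M) = (M ** M ** M) ** M"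
    by (simp add: matrix_mul_assoc)
  also have "\<dots> = (t *\<^sub>R (M ** M) - s *\<^sub>R M + mat 1) ** M"
    by (simp only: cube)
  also have "\<dots> = t *\<^sub>R (M ** M ** M) - s *\<^sub>R (M ** M) + M"
    by (simp add: matrix_combination_mult)
  \<comment> \<open>The second use of \<open>cube\<close> removes the remaining third power.\<close>
  also have "\<dots> = (t\<^sup>2 - s) *\<^sub>R (M ** M) + (1 - s * t) *\<^sub>R M + t *\<^sub>R mat 1"
    unfolding cube by (simp add: algebra_simps power2_eq_square)
  also have "t\<^sup>2 - s = (t\<^sup>2 + trace (M ** M)) / 2"
    by (simp add: s_def field_simps)
  finally show ?thesis
    by (simp add: t_def s_def)
qed

text \<open>The divisions in the formula call for real scalars; this lemma and the next carry the
  integer hypotheses over.\<close>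

lemma real_matrix_mult: "real_matrix (M ** N) = real_matrix M ** real_matrix N"
  by (simp add: real_matrix_def map_matrix_def matrix_matrix_mult_def vec_eq_iff)

lemma det_real_matrix: "det (real_matrix M) = real_of_int (det M)"
  by (simp add: real_matrix_def map_matrix_def det_def)

theorem mainTheorem7:
  fixes A B :: "int^3^3"
  assumes "A \<in> SL3Z"
    and "B \<in> SL3Z" and "B ** B = A"
    and "1 - ((trace (real_matrix B))\<^sup>2 - trace (real_matrix A)) / 2 * trace (real_matrix B) \<noteq> 0"
  shows "real_matrix B =
    (real_matrix A ** real_matrix A
      - (((trace (real_matrix B))\<^sup>2 + trace (real_matrix A)) / 2) *\<^sub>R real_matrix A
      - trace (real_matrix B) *\<^sub>R mat 1)
    /\<^sub>R (1 - ((trace (real_matrix B))\<^sup>2 - trace (real_matrix A)) / 2 * trace (real_matrix B))"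
proof -
  have A: "real_matrix A = real_matrix B ** real_matrix B"
    using assms(3) real_matrix_mult by metis
  have "det (real_matrix B) = 1"
    using assms(2) by (simp add: SL3Z_def det_real_matrix)
  \<comment> \<open>Folding with \<open>A\<close> replaces the square of
    \<open>real_matrix B\<close> everywhere, also inside the traces.\<close>
  from matrix_power4_3[OF this, folded A]
  have "real_matrix A ** real_matrix A
      - (((trace (real_matrix B))\<^sup>2 + trace (real_matrix A)) / 2) *\<^sub>R real_matrix A
      - trace (real_matrix B) *\<^sub>R mat 1
    = (1 - ((trace (real_matrix B))\<^sup>2 - trace (real_matrix A)) / 2 * trace (real_matrix B))
      *\<^sub>R real_matrix B"
    by simp
  then show ?thesis
    using assms(4) by simp
qed

end
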